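(* Let $\mathcal U,\mathcal Y$, $A$, $\{u^i,y^i\}_{i\in\mathbb N}$, $\mathcal U_n$, $\mathcal Y_n$, $P_{\mathcal U_n}$, $P_{\mathcal Y_n}$ be as described in the context. Then for every $n\in\mathbb N$ the Moore-Penrose inverse of the operator $AP_{\mathcal U_n}\colon\mathcal U\to\mathcal Y$ is given by $$(AP_{\mathcal U_n})^\dagger = A^{-1}P_{\mathcal Y_n}.$$
   Context: $\mathcal U$ and $\mathcal Y$ are separable Hilbert spaces and $A\colon\mathcal U\to\mathcal Y$ is a bounded linear injective operator whose inverse $A^{-1}\colon\mathcal R(A)\to\mathcal U$, defined on the range $\mathcal R(A)$, is unbounded. The training pairs $\{u^i,y^i\}_{i\in\mathbb N}\subset\mathcal U\times\mathcal Y$ satisfy $Au^i=y^i$ for all $i$; for every $n$ the inputs $u^1,\dots,u^n$ are linearly independent; $\|u^i\|=1$ for all $i$; and $\overline{\bigcup_{n}\mathcal U_n}=\mathcal U$, where $\mathcal U_n:=\mathrm{Span}\{u^1,\dots,u^n\}$. Further $\mathcal Y_n:=\mathrm{Span}\{y^1,\dots,y^n\}$, and $P_{\mathcal U_n}$, $P_{\mathcal Y_n}$ denote the orthogonal projections onto $\mathcal U_n$ and $\mathcal Y_n$. Note $\mathcal Y_n\subset\mathcal R(A)$, so $A^{-1}P_{\mathcal Y_n}$ is defined on all of $\mathcal Y$. *)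

theory Defs
  imports "HOL-Analysis.Analysis"
begin

text \<open>
  Hilbert spaces are treated over a scalar field that is either the reals or the complex numbers.
  By the Gelfand--Mazur theorem, a real normed field (with multiplicative norm) is
  isometrically isomorphic to one of these two, and \<open>mult_scnj\<close> determines the conjugation.
\<close>

class scalar_field = real_normed_field +
  fixes scnj :: "'a \<Rightarrow> 'a"
  assumes scnj_add: "scnj (a + b) = scnj a + scnj b"
    and scnj_mult: "scnj (a * b) = scnj a * scnj b"
    and scnj_scnj: "scnj (scnj a) = a"
    and mult_scnj: "a * scnj a = (norm a)\<^sup>2 *\<^sub>R 1"

instantiation real :: scalar_field
begin
definition scnj_real :: "real \<Rightarrow> real" where "scnj_real a = a"
instance
  by intro_classes (simp_all add: scnj_real_def power2_eq_square)
end

instantiation complex :: scalar_field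
begin
definition scnj_complex :: "complex \<Rightarrow> complex" where "scnj_complex = cnj"
instance
proof
  fix a b :: complex
  show "a * scnj a = (norm a)\<^sup>2 *\<^sub>R 1"
    unfolding scnj_complex_def scaleR_conv_of_real complex_norm_square by (rule mult_1_right [symmetric])
qed (simp_all add: scnj_complex_def)
end

text \<open>
  Norm, topology, completeness and the underlying real vector space come from the type class
  \<^class>\<open>banach\<close>; \<open>ip_self\<close> says that the norm is the one induced by the inner product.
\<close>

locale hilbert_space = vector_space scale
  for scale :: "'k::scalar_field \<Rightarrow> 'a::banach \<Rightarrow> 'a" +
  fixes ip :: "'a \<Rightarrow> 'a \<Rightarrow> 'k"
  assumes scale_of_real: "scale (of_real r) x = r *\<^sub>R x"
    and ip_add_left: "ip (x + y) z = ip x z + ip y z"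
    and ip_scale_left: "ip (scale c x) y = c * ip x y"
    and ip_commute: "ip y x = scnj (ip x y)"
    and ip_self: "ip x x = of_real ((norm x)\<^sup>2)"

lemma hilbert_space_real:
  "hilbert_space scaleR (inner :: 'a::{real_inner, banach} \<Rightarrow> 'a \<Rightarrow> real)"
proof unfold_locales
  fix x y :: 'a
  show "inner y x = scnj (inner x y)"
    unfolding scnj_real_def by (rule inner_commute)
qed (simp_all add: scaleR_add_right scaleR_add_left inner_add_left power2_norm_eq_inner)

lemma hilbert_space_complex: "hilbert_space (*) (\<lambda>x y :: complex. x * cnj y)"
proof unfold_locales
  fix x :: complex
  show "x * cnj x = of_real ((norm x)\<^sup>2)"
    by (rule complex_norm_square [symmetric])
qed (simp_all add: distrib_left distrib_right scaleR_conv_of_real scnj_complex_def)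

definition orth_compl :: "('a \<Rightarrow> 'a \<Rightarrow> 'k::zero) \<Rightarrow> 'a set \<Rightarrow> 'a set" where
  "orth_compl ip S = {x. \<forall>s\<in>S. ip x s = 0}"

definition orth_proj :: "('a::minus \<Rightarrow> 'a \<Rightarrow> 'k::zero) \<Rightarrow> 'a set \<Rightarrow> 'a \<Rightarrow> 'a" where
  "orth_proj ip V x = (THE p. p \<in> V \<and> x - p \<in> orth_compl ip V)"

text \<open>
  The Moore--Penrose inverse of \<open>T\<close> is in general only densely defined, hence a partial map:
  it is the linear extension of the inverse of \<open>T\<close> restricted to the orthogonal complement
  of its null space, with domain the sum of the range of \<open>T\<close> and the orthogonal complement of
  that range, and with null space the latter complement.
\<close>

definition is_moore_penrose_inverse ::
  "('k::zero \<Rightarrow> 'u::real_vector \<Rightarrow> 'u) \<Rightarrow> ('u \<Rightarrow> 'u \<Rightarrow> 'k) \<Rightarrow>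
   ('k \<Rightarrow> 'y::real_vector \<Rightarrow> 'y) \<Rightarrow> ('y \<Rightarrow> 'y \<Rightarrow> 'k) \<Rightarrow>
   ('u \<Rightarrow> 'y) \<Rightarrow> ('y \<rightharpoonup> 'u) \<Rightarrow> bool" where
  "is_moore_penrose_inverse scaleU ipU scaleY ipY T S \<longleftrightarrow>
     dom S = {y + z | y z. y \<in> range T \<and> z \<in> orth_compl ipY (range T)} \<and>
     (\<forall>y z a b. S y = Some a \<and> S z = Some b \<longrightarrow> S (y + z) = Some (a + b)) \<and>
     (\<forall>c y a. S y = Some a \<longrightarrow> S (scaleY c y) = Some (scaleU c a)) \<and>
     (\<forall>x \<in> orth_compl ipU {x. T x = 0}. S (T x) = Some x) \<and>
     {y. S y = Some 0} = orth_compl ipY (range T)"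

definition moore_penrose_inverse ::
  "('k::zero \<Rightarrow> 'u::real_vector \<Rightarrow> 'u) \<Rightarrow> ('u \<Rightarrow> 'u \<Rightarrow> 'k) \<Rightarrow>
   ('k \<Rightarrow> 'y::real_vector \<Rightarrow> 'y) \<Rightarrow> ('y \<Rightarrow> 'y \<Rightarrow> 'k) \<Rightarrow>
   ('u \<Rightarrow> 'y) \<Rightarrow> ('y \<rightharpoonup> 'u)" where
  "moore_penrose_inverse scaleU ipU scaleY ipY T =
     (THE S. is_moore_penrose_inverse scaleU ipU scaleY ipY T S)"

end

theory Submission
  imports Defs
begin

text \<open>
  The orthogonal complement of the null space of \<open>A P\<^sub>U\<close> is the subspace \<open>U\<close> itself, because
  injectivity of \<open>A\<close> makes that null space equal to the orthogonal complement of \<open>U\<close>; and the range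
  of \<open>A P\<^sub>U\<close> is \<open>A U\<close>. So inverting \<open>A P\<^sub>U\<close> between these two spaces means inverting \<open>A\<close> from
  \<open>A U\<close> to \<open>U\<close>, and extending this inverse by zero on the orthogonal complement of \<open>A U\<close> means
  composing it with the projection onto \<open>A U\<close>. This argument
  (\<open>moore_penrose_inverse_comp_orth_proj\<close>) works as soon as orthogonal projections onto \<open>U\<close> and
  \<open>A U\<close> exist. For spans of finitely many vectors they are built by Gram--Schmidt steps
  (\<open>admits_orth_proj_span\<close>), and \<open>A\<close> maps the span of the inputs onto the span of their images.

  The Moore--Penrose inverse is specified by a definite description, so uniqueness has to be proved
  as well. The conditions fix the inverse at \<open>T x\<close> for \<open>x\<close> orthogonal to the null space of \<open>T\<close>,
  hence on the range of \<open>T\<close> once \<open>T\<close> maps the complement of its null space onto its range, and by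
  additivity on the whole domain (\<open>is_moore_penrose_inverse_unique\<close>).
\<close>

section \<open>Inner products and orthogonal projections\<close>

lemma (in hilbert_space) ip_zero_left [simp]: "ip 0 z = 0"
  using ip_scale_left[of 0 0 z] by simp

lemma scnj_zero [simp]: "scnj (0::'k::scalar_field) = 0"
  using scnj_add[of "0::'k" 0] by simp

lemma (in hilbert_space) ip_zero_right [simp]: "ip z 0 = 0"
  using ip_commute[of z 0] by simp

lemma (in hilbert_space) ip_add_right: "ip x (y + z) = ip x y + ip x z"
  by (metis ip_commute ip_add_left scnj_add)

lemma (in hilbert_space) ip_scale_right: "ip x (scale c y) = scnj c * ip x y"
  by (metis ip_commute ip_scale_left scnj_mult)

lemma (in hilbert_space) ip_diff_left: "ip (x - y) z = ip x z - ip y z"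
  using ip_add_left[of "x - y" y z] by simp

lemma (in hilbert_space) ip_eq_zero_commute: "ip x y = 0 \<longleftrightarrow> ip y x = 0"
  by (metis ip_commute scnj_zero)

lemma (in hilbert_space) ip_self_eq_zero_iff [simp]: "ip x x = 0 \<longleftrightarrow> x = 0"
  by (simp add: ip_self)

lemma (in hilbert_space) subspace_orth_compl: "subspace (orth_compl ip S)"
  by (rule subspaceI) (auto simp: orth_compl_def ip_add_left ip_scale_left)

lemma (in hilbert_space) subspace_orthogonal_to: "subspace {s. ip x s = 0}"
  by (rule subspaceI) (auto simp: ip_add_right ip_scale_right)

lemma (in hilbert_space) orth_compl_span: "orth_compl ip (span S) = orth_compl ip S"
proof
  show "orth_compl ip (span S) \<subseteq> orth_compl ip S"
    by (auto simp: orth_compl_def span_base)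
  show "orth_compl ip S \<subseteq> orth_compl ip (span S)"
  proof
    fix x assume "x \<in> orth_compl ip S"
    then have "S \<subseteq> {s. ip x s = 0}"
      by (auto simp: orth_compl_def)
    then have "span S \<subseteq> {s. ip x s = 0}"
      using subspace_orthogonal_to by (rule span_minimal)
    then show "x \<in> orth_compl ip (span S)"
      by (auto simp: orth_compl_def)
  qed
qed

lemma (in hilbert_space) in_subspace_and_orth_compl_eq_zero:
  assumes "x \<in> V" and "x \<in> orth_compl ip V"
  shows "x = 0"
  using assms by (auto simp: orth_compl_def)

definition admits_orth_proj :: "('a::minus \<Rightarrow> 'a \<Rightarrow> 'k::zero) \<Rightarrow> 'a set \<Rightarrow> bool" where
  "admits_orth_proj ip V \<longleftrightarrow> (\<forall>x. \<exists>p\<in>V. x - p \<in> orth_compl ip V)"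

lemma (in hilbert_space) orth_proj_eqI:
  assumes V: "subspace V" and p: "p \<in> V" "x - p \<in> orth_compl ip V"
  shows "orth_proj ip V x = p"
  unfolding orth_proj_def
proof (rule the_equality)
  show "p \<in> V \<and> x - p \<in> orth_compl ip V"
    using p by simp
  fix q assume q: "q \<in> V \<and> x - q \<in> orth_compl ip V"
  have "q - p \<in> V"
    using V p q by (simp add: subspace_diff)
  moreover have "(x - p) - (x - q) \<in> orth_compl ip V"
    using p q by (simp only: subspace_diff[OF subspace_orth_compl])
  ultimately have "q - p = 0"
    by (intro in_subspace_and_orth_compl_eq_zero[of _ V]) simp_all
  then show "q = p"
    by simp
qed

lemma (in hilbert_space) orth_proj_characterization:
  assumes "subspace V" and "admits_orth_proj ip V"
  shows orth_proj_in: "orth_proj ip V x \<in> V"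
    and diff_orth_proj_in: "x - orth_proj ip V x \<in> orth_compl ip V"
proof -
  obtain p where p: "p \<in> V" "x - p \<in> orth_compl ip V"
    using assms(2) by (auto simp: admits_orth_proj_def)
  then have "orth_proj ip V x = p"
    using assms(1) by (intro orth_proj_eqI)
  with p show "orth_proj ip V x \<in> V" "x - orth_proj ip V x \<in> orth_compl ip V"
    by simp_all
qed

lemma (in hilbert_space) orth_proj_of_mem:
  assumes "subspace V" and "x \<in> V"
  shows "orth_proj ip V x = x"
  using assms by (intro orth_proj_eqI) (simp_all add: subspace_0[OF subspace_orth_compl])

lemma (in hilbert_space) orth_proj_add:
  assumes V: "subspace V" "admits_orth_proj ip V"
  shows "orth_proj ip V (x + y) = orth_proj ip V x + orth_proj ip V y"
proof (rule orth_proj_eqI[OF V(1)])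
  show "orth_proj ip V x + orth_proj ip V y \<in> V"
    using V by (intro subspace_add orth_proj_in)
  have "(x - orth_proj ip V x) + (y - orth_proj ip V y) \<in> orth_compl ip V"
    using V by (intro subspace_add[OF subspace_orth_compl] diff_orth_proj_in)
  then show "x + y - (orth_proj ip V x + orth_proj ip V y) \<in> orth_compl ip V"
    by (simp add: algebra_simps)
qed

lemma (in hilbert_space) orth_proj_scale:
  assumes V: "subspace V" "admits_orth_proj ip V"
  shows "orth_proj ip V (scale c x) = scale c (orth_proj ip V x)"
proof (rule orth_proj_eqI[OF V(1)])
  show "scale c (orth_proj ip V x) \<in> V"
    using V by (intro subspace_scale orth_proj_in)
  have "scale c (x - orth_proj ip V x) \<in> orth_compl ip V"
    using V by (intro subspace_scale[OF subspace_orth_compl] diff_orth_proj_in)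
  then show "scale c x - scale c (orth_proj ip V x) \<in> orth_compl ip V"
    by (simp add: scale_right_diff_distrib)
qed

lemma (in hilbert_space) orth_proj_eq_zero_iff:
  assumes V: "subspace V" "admits_orth_proj ip V"
  shows "orth_proj ip V x = 0 \<longleftrightarrow> x \<in> orth_compl ip V"
proof
  show "orth_proj ip V x = 0 \<Longrightarrow> x \<in> orth_compl ip V"
    using diff_orth_proj_in[OF V, of x] by simp
  show "x \<in> orth_compl ip V \<Longrightarrow> orth_proj ip V x = 0"
    using V(1) by (intro orth_proj_eqI) (simp_all add: subspace_0)
qed

text \<open>
  The part of \<open>x\<close> orthogonal to \<open>V\<close> is itself orthogonal to \<open>x\<close> when \<open>x\<close> lies in the double
  complement; being also orthogonal to the projection of \<open>x\<close>, it is orthogonal to itself.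
\<close>

lemma (in hilbert_space) orth_compl_orth_compl:
  assumes V: "subspace V" "admits_orth_proj ip V"
  shows "orth_compl ip (orth_compl ip V) = V"
proof
  show "V \<subseteq> orth_compl ip (orth_compl ip V)"
    by (auto simp: orth_compl_def ip_eq_zero_commute)
  show "orth_compl ip (orth_compl ip V) \<subseteq> V"
  proof
    fix x assume x: "x \<in> orth_compl ip (orth_compl ip V)"
    let ?p = "orth_proj ip V x"
    have r: "x - ?p \<in> orth_compl ip V"
      using V by (rule diff_orth_proj_in)
    have "ip x (x - ?p) = 0"
      using x r by (auto simp: orth_compl_def)
    moreover have "ip ?p (x - ?p) = 0"
      using r orth_proj_in[OF V] by (auto simp: orth_compl_def ip_eq_zero_commute)
    ultimately have "ip (x - ?p) (x - ?p) = 0"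
      by (simp add: ip_diff_left)
    then have "x = ?p"
      by simp
    then show "x \<in> V"
      using orth_proj_in[OF V, of x] by simp
  qed
qed

text \<open>
  Gram--Schmidt: when a vector \<open>b\<close> is added to the spanning set, the projection grows by the
  component along the residual of \<open>b\<close> against the old span.
\<close>

lemma (in hilbert_space) admits_orth_proj_span:
  assumes "finite B"
  shows "admits_orth_proj ip (span B)"
  using assms
proof induction
  case empty
  show ?case
    by (simp add: admits_orth_proj_def orth_compl_def)
next
  case (insert b B)
  obtain q where q: "q \<in> span B" "b - q \<in> orth_compl ip (span B)"
    using insert.IH by (auto simp: admits_orth_proj_def)
  define r where "r = b - q"
  have r_orth: "ip r s = 0" if "s \<in> span B" for s
    using q(2) that by (simp add: orth_compl_def r_def)
  have q': "q \<in> span (insert b B)"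
    using q(1) span_mono[of B "insert b B"] by blast
  have r_in: "r \<in> span (insert b B)"
    unfolding r_def using q' by (intro span_diff) (simp_all add: span_base)
  have "\<exists>p\<in>span (insert b B). x - p \<in> orth_compl ip (span (insert b B))" for x
  proof -
    obtain p where p: "p \<in> span B" "x - p \<in> orth_compl ip (span B)"
      using insert.IH by (auto simp: admits_orth_proj_def)
    (* If r = 0, division by zero makes the coefficient 0, and b already lies in the span of B. *)
    define c where "c = ip (x - p) r / ip r r"
    define p' where "p' = p + scale c r"
    have "p' \<in> span (insert b B)"
      unfolding p'_def using p(1) r_in span_mono[of B "insert b B"]
      by (intro span_add span_scale) auto
    moreover have "x - p' \<in> orth_compl ip (insert b B)"
    proof -
      have x_p': "x - p' = (x - p) - scale c r"
        by (simp add: p'_def)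
      have on_span: "ip (x - p') s = 0" if "s \<in> span B" for s
        using p(2) r_orth[OF that] that
        unfolding x_p' ip_diff_left[of "x - p"] ip_scale_left by (simp add: orth_compl_def)
      have "ip (x - p') r = 0"
        unfolding x_p' ip_diff_left[of "x - p"] ip_scale_left by (cases "r = 0") (simp_all add: c_def)
      moreover have "ip (x - p') q = 0"
        using q(1) by (rule on_span)
      ultimately have "ip (x - p') (r + q) = 0"
        unfolding ip_add_right by simp
      then have "ip (x - p') b = 0"
        by (simp add: r_def)
      then show ?thesis
        using on_span by (auto simp: orth_compl_def span_base)
    qed
    ultimately show ?thesis
      unfolding orth_compl_span by blast
  qed
  then show ?case
    by (simp add: admits_orth_proj_def)
qed

section \<open>The Moore--Penrose inverse\<close>

text \<open>
  The defining conditions give the value at \<open>T x\<close> only for \<open>x\<close> orthogonal to the null space. If that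
  null space is dense and proper, only \<open>x = 0\<close> qualifies and the values on the range stay open; the
  third hypothesis excludes this by having every point of the range attained on the complement.
\<close>

lemma is_moore_penrose_inverse_unique:
  assumes S: "is_moore_penrose_inverse scaleU ipU scaleY ipY T S"
    and S': "is_moore_penrose_inverse scaleU ipU scaleY ipY T S'"
    and range: "range T \<subseteq> T ` orth_compl ipU {x. T x = 0}"
  shows "S = S'"
proof
  fix w
  have dom: "dom S = {y + z | y z. y \<in> range T \<and> z \<in> orth_compl ipY (range T)}"
    and dom_eq: "dom S' = dom S"
    using S S' by (simp_all add: is_moore_penrose_inverse_def)
  show "S w = S' w"
  proof (cases "w \<in> dom S")
    case False
    then show ?thesis
      using dom_eq by (metis domIff)
  next
    case True
    then obtain y z where w: "w = y + z" and y: "y \<in> range T" and z: "z \<in> orth_compl ipY (range T)"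
      unfolding dom by blast
    obtain x where x: "x \<in> orth_compl ipU {x. T x = 0}" "y = T x"
      using y range by blast
    have R_w: "R w = Some (x + 0)"
      if R: "is_moore_penrose_inverse scaleU ipU scaleY ipY T R" for R
    proof -
      have "R y = Some x"
        using R x by (simp add: is_moore_penrose_inverse_def)
      moreover have "R z = Some 0"
        using R z unfolding is_moore_penrose_inverse_def by blast
      ultimately show ?thesis
        using R unfolding is_moore_penrose_inverse_def w by blast
    qed
    show ?thesis
      using R_w[OF S] R_w[OF S'] by simp
  qed
qed

theorem moore_penrose_inverse_comp_orth_proj:
  fixes scaleU :: "'k::scalar_field \<Rightarrow> 'u::banach \<Rightarrow> 'u"
    and scaleY :: "'k \<Rightarrow> 'y::banach \<Rightarrow> 'y"
  assumes HU: "hilbert_space scaleU ipU" and HY: "hilbert_space scaleY ipY"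
    and lin: "Vector_Spaces.linear scaleU scaleY A" and inj: "inj A"
    and V: "module.subspace scaleU V" "admits_orth_proj ipU V"
    and AV: "admits_orth_proj ipY (A ` V)"
  shows "moore_penrose_inverse scaleU ipU scaleY ipY (\<lambda>x. A (orth_proj ipU V x)) =
           (\<lambda>z. Some (inv A (orth_proj ipY (A ` V) z)))"
proof -
  interpret U: hilbert_space scaleU ipU by (fact HU)
  interpret Y: hilbert_space scaleY ipY by (fact HY)
  interpret A: Vector_Spaces.linear scaleU scaleY A by (fact lin)
  let ?T = "\<lambda>x. A (orth_proj ipU V x)"
  let ?P = "orth_proj ipY (A ` V)"
  let ?S = "\<lambda>z. Some (inv A (?P z))"
  have sub: "Y.subspace (A ` V)"
    using V(1) by (rule A.subspace_image)
  have P_in: "?P z \<in> A ` V" for z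
    using sub AV by (rule Y.orth_proj_in)
  have A_inv: "A (inv A (?P z)) = ?P z" for z
    using P_in[of z] by (intro f_inv_into_f) blast
  have inv_A: "inv A (A x) = x" for x
    using inj by (rule inv_f_f)
  have T_on_V: "?T x = A x" if "x \<in> V" for x
    using U.orth_proj_of_mem[OF V(1) that] by simp
  have range_T: "range ?T = A ` V"
  proof
    show "range ?T \<subseteq> A ` V"
      using U.orth_proj_in[OF V] by blast
    show "A ` V \<subseteq> range ?T"
      using T_on_V by (metis image_subsetI rangeI)
  qed
  have A_zero_iff: "A x = 0 \<longleftrightarrow> x = 0" for x
    using inj A.zero by (metis injD)
  have "{x. ?T x = 0} = orth_compl ipU V"
    using U.orth_proj_eq_zero_iff[OF V] by (simp add: A_zero_iff)
  then have ker_T_compl: "orth_compl ipU {x. ?T x = 0} = V"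
    using U.orth_compl_orth_compl[OF V] by simp
  have MP: "is_moore_penrose_inverse scaleU ipU scaleY ipY ?T ?S"
    unfolding is_moore_penrose_inverse_def range_T ker_T_compl
  proof (intro conjI allI impI ballI)
    have "w \<in> {y + z | y z. y \<in> A ` V \<and> z \<in> orth_compl ipY (A ` V)}" for w
    proof -
      have "w = ?P w + (w - ?P w)"
        by simp
      then show ?thesis
        using P_in[of w] Y.diff_orth_proj_in[OF sub AV, of w] by blast
    qed
    then show "dom ?S = {y + z | y z. y \<in> A ` V \<and> z \<in> orth_compl ipY (A ` V)}"
      by (auto simp: dom_def)
  next
    fix y z a b assume "?S y = Some a \<and> ?S z = Some b"
    then have "A (a + b) = ?P (y + z)"
      using A_inv by (auto simp: A.add Y.orth_proj_add[OF sub AV])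
    then show "?S (y + z) = Some (a + b)"
      using inv_A by metis
  next
    fix c y a assume "?S y = Some a"
    then have "A (scaleU c a) = ?P (scaleY c y)"
      using A_inv by (auto simp: A.scale Y.orth_proj_scale[OF sub AV])
    then show "?S (scaleY c y) = Some (scaleU c a)"
      using inv_A by metis
  next
    fix x assume x: "x \<in> V"
    then show "?S (?T x) = Some x"
      by (simp add: T_on_V Y.orth_proj_of_mem[OF sub] inv_A)
  next
    have "inv A (?P z) = 0 \<longleftrightarrow> ?P z = 0" for z
      using A_inv[of z] A_zero_iff by metis
    then show "{y. ?S y = Some 0} = orth_compl ipY (A ` V)"
      using Y.orth_proj_eq_zero_iff[OF sub AV] by simp
  qed
  have "range ?T \<subseteq> ?T ` orth_compl ipU {x. ?T x = 0}"
    unfolding range_T ker_T_compl using T_on_V by (metis image_cong subset_refl)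
  then show ?thesis
    unfolding moore_penrose_inverse_def
    using MP by (intro the_equality) (auto intro: is_moore_penrose_inverse_unique)
qed

theorem theorem4:
  fixes scaleU :: "'k::scalar_field \<Rightarrow> 'u::banach \<Rightarrow> 'u"
    and ipU :: "'u \<Rightarrow> 'u \<Rightarrow> 'k"
    and scaleY :: "'k \<Rightarrow> 'y::banach \<Rightarrow> 'y"
    and ipY :: "'y \<Rightarrow> 'y \<Rightarrow> 'k"
    and A :: "'u \<Rightarrow> 'y"
    and u :: "nat \<Rightarrow> 'u"
    and y :: "nat \<Rightarrow> 'y"
    and Usp :: "nat \<Rightarrow> 'u set"
    and Ysp :: "nat \<Rightarrow> 'y set"
    and n :: nat
  defines "Usp \<equiv> \<lambda>m. module.span scaleU (u ` {1..m})"
    and "Ysp \<equiv> \<lambda>m. module.span scaleY (y ` {1..m})"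
  assumes "hilbert_space scaleU ipU"
    and "hilbert_space scaleY ipY"
    and "separable_space (euclidean :: 'u topology)"
    and "separable_space (euclidean :: 'y topology)"
    and "Vector_Spaces.linear scaleU scaleY A"
    and "bounded_linear A"
    and "inj A"
    and inverse_unbounded: "\<not> (\<exists>K. \<forall>z\<in>range A. norm (inv A z) \<le> K * norm z)"
    and "\<And>i. i \<ge> 1 \<Longrightarrow> A (u i) = y i"
    and "\<And>m. inj_on u {1..m} \<and> \<not> module.dependent scaleU (u ` {1..m})"
    and "\<And>i. i \<ge> 1 \<Longrightarrow> norm (u i) = 1"
    and "closure (\<Union>m\<in>{1..}. Usp m) = UNIV"
    and "n \<ge> 1"
  shows "moore_penrose_inverse scaleU ipU scaleY ipY (\<lambda>x. A (orth_proj ipU (Usp n) x)) =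
           (\<lambda>z. Some (inv A (orth_proj ipY (Ysp n) z)))"
proof -
  interpret U: hilbert_space scaleU ipU by (fact assms)
  interpret Y: hilbert_space scaleY ipY by (fact assms)
  interpret A: Vector_Spaces.linear scaleU scaleY A by (fact assms)
  have "y ` {1..n} = A ` u ` {1..n}"
    using assms by (force simp: image_image)
  then have image_Usp: "A ` Usp n = Ysp n"
    unfolding Usp_def Ysp_def by (simp add: A.span_image)
  show ?thesis
    unfolding image_Usp[symmetric]
  proof (rule moore_penrose_inverse_comp_orth_proj)
    show "module.subspace scaleU (Usp n)"
      unfolding Usp_def by (rule U.subspace_span)
    show "admits_orth_proj ipU (Usp n)"
      unfolding Usp_def by (rule U.admits_orth_proj_span) simp
    show "admits_orth_proj ipY (A ` Usp n)"
      unfolding image_Usp Ysp_def by (rule Y.admits_orth_proj_span) simp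
  qed (fact assms)+
qed

end
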